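(* Let $K$ be a commutative field with $\operatorname{Char}K\neq3$. Let $F\subset\mathbb{P}_3(K)$ be the Cayley surface $F=\mathcal{V}(X_0X_1X_2-X_1^3-X_0^2X_3)$, let $g_\infty=\mathcal{V}(X_0,X_1)$, and let $\mathcal{O}$ be the set of lines of $\mathbb{P}_3(K)$ consisting of all proper osculating tangents of $F$ together with $g_\infty$. Let $\mathcal{L}[Z,\omega]$ be the pencil of all lines that lie in the plane $\omega=\mathcal{V}(X_0)$ and pass through the point $Z=K(0,0,0,1)^T$. Consider the polynomials $$h_1(\mathbf{Y}):=3Y_{01}(Y_{12}+Y_{03})-Y_{02}^2,$$ $$h_2(\mathbf{Y}):=3Y_{02}Y_{13}-(Y_{12}+Y_{03})^2,$$ $$h_3(\mathbf{Y}):=9Y_{01}Y_{13}-Y_{02}(Y_{12}+Y_{03}).$$ Then $\kappa(\mathcal{O}\cup\mathcal{L}[Z,\omega])$, where $\kappa$ is the Klein mapping, equals the intersection of the variety $$J:=\mathcal{V}(h_1(\mathbf{Y}),h_2(\mathbf{Y}),h_3(\mathbf{Y}))\subset\mathbb{P}_5(K)$$ with the Klein quadric $Q=\mathcal{V}(Y_{01}Y_{23}-Y_{02}Y_{13}+Y_{03}Y_{12})$.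
   Context: Points of the projective space $\mathbb{P}_3(K)$ are the one-dimensional subspaces $K\mathbf{p}$ with $0\neq\mathbf{p}=(p_0,p_1,p_2,p_3)^{T}\in K^{4\times1}$; similarly for $\mathbb{P}_5(K)$ with $K^{6\times 1}$. For homogeneous polynomials $g_1,\dots,g_r$ over $K$, $\mathcal{V}(g_1,\dots,g_r)$ denotes the set of ($K$-rational) points at which $g_1,\dots,g_r$ all vanish, in $\mathbb{P}_3(K)$ for polynomials in $X_0,\dots,X_3$ and in $\mathbb{P}_5(K)$ for polynomials in $\mathbf{Y}=(Y_{01},Y_{02},Y_{03},Y_{12},Y_{13},Y_{23})$. Put $f:=X_0X_1X_2-X_1^3-X_0^2X_3$, so $F=\mathcal{V}(f)$. A point of $F$ is simple if not all the partial derivatives $\partial f/\partial X_i$ vanish there. The simple points of $F$ are exactly the points of $F$ outside $\omega$, namely $P(u_1,u_2)=K(1,u_1,u_2,u_1u_2-u_1^3)^T$ with $(u_1,u_2)\in K^2$. A generator of $F$ is one of the lines spanned by $K(s_0^2,s_0s_1,s_1^2,0)^T$ and $K(0,0,s_0,s_1)^T$, with $(s_0,s_1)\in K^2\setminus\{(0,0)\}$; these are the lines contained in $F$. A line $t$ is an osculating tangent of $F$ at a simple point $P=K\mathbf{p}$ if it meets $F$ at $P$ with multiplicity $\geq 3$: for $t=K\mathbf{p}+K\mathbf{q}$ the polynomial $f(\mathbf{p}+T\mathbf{q})\in K[T]$ is divisible by $T^3$ (possibly zero). A proper osculating tangent of $F$ is an osculating tangent at some simple point that is not a generator of $F$. The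 Klein mapping $\kappa$ sends a line $K\mathbf{p}+K\mathbf{q}$ of $\mathbb{P}_3(K)$ to the point $K(y_{01},y_{02},y_{03},y_{12},y_{13},y_{23})^T$ of $\mathbb{P}_5(K)$, where $y_{ij}=p_iq_j-p_jq_i$ (Plücker coordinates); it is a bijection from the set of lines of $\mathbb{P}_3(K)$ onto $Q$. *)

theory Defs
  imports "HOL-Analysis.Analysis" "HOL-Computational_Algebra.Polynomial"
begin

text \<open>
  Points are one-dimensional subspaces of \<open>'a ^ 'n\<close>; lines, planes and varieties are
  sets of points.  Coordinates are numbered from 0: \<open>X\<^sub>i\<close> is \<open>x $ i\<close> for \<open>x :: 'a ^ 4\<close>, and
  \<open>Y\<^sub>0\<^sub>1, Y\<^sub>0\<^sub>2, Y\<^sub>0\<^sub>3, Y\<^sub>1\<^sub>2, Y\<^sub>1\<^sub>3, Y\<^sub>2\<^sub>3\<close> are \<open>y $ 0, \<dots>, y $ 5\<close> for \<open>y :: 'a ^ 6\<close>.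
\<close>

definition coords4 :: "'a \<Rightarrow> 'a \<Rightarrow> 'a \<Rightarrow> 'a \<Rightarrow> 'a ^ 4" where
  "coords4 a b c d = (\<chi> i. if i = 0 then a else if i = 1 then b else if i = 2 then c else d)"

definition coords6 :: "'a \<Rightarrow> 'a \<Rightarrow> 'a \<Rightarrow> 'a \<Rightarrow> 'a \<Rightarrow> 'a \<Rightarrow> 'a ^ 6" where
  "coords6 a b c d e f = (\<chi> i. if i = 0 then a else if i = 1 then b else if i = 2 then c
     else if i = 3 then d else if i = 4 then e else f)"

definition proj_point :: "'a::field ^ 'n \<Rightarrow> ('a ^ 'n) set" where
  "proj_point p = vec.span {p}"

definition proj_points :: "('a::field ^ 'n) set \<Rightarrow> ('a ^ 'n) set set" where
  "proj_points U = {proj_point p | p. p \<in> U \<and> p \<noteq> 0}"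

definition proj_lines :: "('a::field ^ 'n) set set set" where
  "proj_lines = {proj_points U | U. vec.subspace U \<and> vec.dim U = 2}"

text \<open>This is a line only if \<open>p\<close> and \<open>q\<close> are linearly independent.\<close>

definition join :: "'a::field ^ 'n \<Rightarrow> 'a ^ 'n \<Rightarrow> ('a ^ 'n) set set" where
  "join p q = proj_points (vec.span {p, q})"

definition variety :: "('a::field ^ 'n \<Rightarrow> 'a) set \<Rightarrow> ('a ^ 'n) set set" where
  "variety G = {proj_point p | p. p \<noteq> 0 \<and> (\<forall>g\<in>G. g p = 0)}"

text \<open>
  The form \<open>f\<close> is polymorphic in the coefficient ring, so that it can also be evaluated at
  vectors over \<open>K[T]\<close>.  This yields formal (not merely functional) substitutions and
  derivatives, also over finite fields.
\<close>

definition cayley_form :: "'a::comm_ring_1 ^ 4 \<Rightarrow> 'a" where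
  "cayley_form x = x $ 0 * x $ 1 * x $ 2 - (x $ 1) ^ 3 - (x $ 0)\<^sup>2 * x $ 3"

definition cayley_surface :: "('a::field ^ 4) set set" where
  "cayley_surface = variety {cayley_form}"

text \<open>The formal derivative with respect to the \<open>i\<close>-th variable, the others held constant.\<close>

definition cayley_partial :: "4 \<Rightarrow> 'a::field ^ 4 \<Rightarrow> 'a" where
  "cayley_partial i p =
     poly (pderiv (cayley_form (\<chi> j. if j = i then [:0, 1:] else [:p $ j:]))) (p $ i)"

definition simple_points :: "('a::field ^ 4) set set" where
  "simple_points = cayley_surface - variety (range cayley_partial)"

definition generators :: "('a::field ^ 4) set set set" where
  "generators = {join (coords4 (s0\<^sup>2) (s0 * s1) (s1\<^sup>2) 0) (coords4 0 0 s0 s1) | s0 s1.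
     (s0, s1) \<noteq> (0, 0)}"

text \<open>The vector \<open>\<chi> i. [:p $ i, q $ i:]\<close> is \<open>p + T q\<close>, and \<open>[:0, 1:]\<close> is \<open>T\<close>.\<close>

definition osculating_tangent_at :: "('a::field ^ 4) set \<Rightarrow> ('a ^ 4) set set \<Rightarrow> bool" where
  "osculating_tangent_at P t \<longleftrightarrow> t \<in> proj_lines \<and>
     (\<exists>p q. P = proj_point p \<and> t = join p q \<and>
        [:0, 1:] ^ 3 dvd cayley_form (\<chi> i. [:p $ i, q $ i:]))"

definition proper_osculating_tangents :: "('a::field ^ 4) set set set" where
  "proper_osculating_tangents =
     {t. \<exists>P\<in>simple_points. osculating_tangent_at P t} - generators"

definition g_infinity :: "('a::field ^ 4) set set" where
  "g_infinity = variety {\<lambda>x. x $ 0, \<lambda>x. x $ 1}"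

definition osculating_set :: "('a::field ^ 4) set set set" where
  "osculating_set = insert g_infinity proper_osculating_tangents"

definition omega :: "('a::field ^ 4) set set" where
  "omega = variety {\<lambda>x. x $ 0}"

definition Z_point :: "('a::field ^ 4) set" where
  "Z_point = proj_point (coords4 0 0 0 1)"

definition line_pencil :: "('a::field ^ 'n) set \<Rightarrow> ('a ^ 'n) set set \<Rightarrow> ('a ^ 'n) set set set" where
  "line_pencil P E = {l \<in> proj_lines. P \<in> l \<and> l \<subseteq> E}"

definition pluecker :: "'a::field ^ 4 \<Rightarrow> 'a ^ 4 \<Rightarrow> 'a ^ 6" where
  "pluecker p q =
     (let y = (\<lambda>i j. p $ i * q $ j - p $ j * q $ i)
      in coords6 (y 0 1) (y 0 2) (y 0 3) (y 1 2) (y 1 3) (y 2 3))"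

text \<open>Well-defined on lines by \<open>klein_map_join\<close> below.\<close>

definition klein_map :: "('a::field ^ 4) set set \<Rightarrow> ('a ^ 6) set" where
  "klein_map l = (THE P. \<exists>p q. l = join p q \<and> P = proj_point (pluecker p q))"

definition klein_quadric :: "('a::field ^ 6) set set" where
  "klein_quadric = variety {\<lambda>y. y $ 0 * y $ 5 - y $ 1 * y $ 4 + y $ 2 * y $ 3}"

definition h1 :: "'a::field ^ 6 \<Rightarrow> 'a" where
  "h1 y = 3 * y $ 0 * (y $ 3 + y $ 2) - (y $ 1)\<^sup>2"

definition h2 :: "'a::field ^ 6 \<Rightarrow> 'a" where
  "h2 y = 3 * y $ 1 * y $ 4 - (y $ 3 + y $ 2)\<^sup>2"

definition h3 :: "'a::field ^ 6 \<Rightarrow> 'a" where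
  "h3 y = 9 * y $ 0 * y $ 4 - y $ 1 * (y $ 3 + y $ 2)"

lemma span_proj_points: "vec.span U = insert 0 (\<Union> (proj_points (vec.span U)))"
proof (intro equalityI subsetI)
  fix x assume "x \<in> vec.span U"
  then show "x \<in> insert 0 (\<Union> (proj_points (vec.span U)))"
    unfolding proj_points_def proj_point_def using vec.span_base[of x "{x}"] by blast
next
  fix x assume "x \<in> insert 0 (\<Union> (proj_points (vec.span U)))"
  then consider "x = 0" | p where "p \<in> vec.span U" "x \<in> vec.span {p}"
    unfolding proj_points_def proj_point_def by blast
  then show "x \<in> vec.span U"
  proof cases
    case 2
    then show ?thesis by (auto simp: vec.span_singleton intro: vec.span_scale)
  qed (simp add: vec.span_zero)
qed

lemma join_eq_iff: "join p q = join p' q' \<longleftrightarrow> vec.span {p, q} = vec.span {p', q'}"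
  unfolding join_def using span_proj_points by metis

lemma pluecker_lincomb:
  "pluecker (a *s p + b *s q) (c *s p + d *s q) = (a * d - b * c) *s pluecker p q"
  by (simp add: vec_eq_iff pluecker_def coords6_def Let_def algebra_simps)

lemma klein_map_join:
  fixes p q :: "'a::field ^ 4"
  shows "klein_map (join p q) = proj_point (pluecker p q)"
  unfolding klein_map_def
proof (rule the_equality)
  fix P assume "\<exists>p' q'. join p q = join p' q' \<and> P = proj_point (pluecker p' q')"
  then obtain p' q' where eq: "vec.span {p, q} = vec.span {p', q'}"
    and P: "P = proj_point (pluecker p' q')" by (auto simp: join_eq_iff)
  have ex: "\<exists>a b. x = a *s u + b *s v" if "x \<in> vec.span {u, v}" for x u v :: "'a ^ 4"
    using that by (auto simp: vec.span_insert vec.span_singleton algebra_simps)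
  have sub: "proj_point (pluecker u v) \<subseteq> proj_point (pluecker r s)"
    if "vec.span {u, v} = vec.span {r, s}" for u v r s :: "'a ^ 4"
  proof -
    have "u \<in> vec.span {r, s}" "v \<in> vec.span {r, s}"
      using that vec.span_base[of u "{u, v}"] vec.span_base[of v "{u, v}"] by auto
    then obtain a b c d where "u = a *s r + b *s s" "v = c *s r + d *s s" using ex by metis
    then have "pluecker u v = (a * d - b * c) *s pluecker r s" by (simp add: pluecker_lincomb)
    then have "pluecker u v \<in> vec.span {pluecker r s}"
      by (metis vec.span_scale vec.span_base singletonI)
    then show ?thesis
      unfolding proj_point_def by (intro vec.span_minimal) auto
  qed
  show "P = proj_point (pluecker p q)"
    using sub[OF eq] sub[OF eq[symmetric]] P by blast
qed blast

end

theory Submission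
  imports Defs
begin

text \<open>
  At \<open>P(u, v) = K(1, u, v, uv - u\<^sup>3)\<close> a tangent direction may be taken as \<open>(0, a, b, d)\<close>.
  Contact of order 3 then amounts to \<open>d = ub + av - 3u\<^sup>2a\<close> and \<open>a(b - 3ua) = 0\<close>.  The factor
  \<open>a = 0\<close> gives the generator through \<open>P(u, v)\<close>, and the other one gives the direction
  \<open>(0, 1, 3u, v)\<close>, which has Pluecker coordinates
  \<open>(1, 3u, v, 3u\<^sup>2 - v, u\<^sup>3, 3u\<^sup>4 - 3u\<^sup>2v + v\<^sup>2)\<close>.  Since 3 is invertible, every point of
  \<open>J \<inter> Q\<close> with \<open>Y\<^sub>0\<^sub>1 \<noteq> 0\<close> has this form with \<open>u\<close> and \<open>v\<close> read off from \<open>Y\<^sub>0\<^sub>2\<close>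
  and \<open>Y\<^sub>0\<^sub>3\<close>.  If \<open>Y\<^sub>0\<^sub>1 = 0\<close>, only \<open>Y\<^sub>1\<^sub>3\<close> and \<open>Y\<^sub>2\<^sub>3\<close> survive, which is the pencil; it
  contains \<open>g\<^sub>\<infinity>\<close>.
\<close>

section \<open>Coordinates of vectors and Pluecker coordinates\<close>

lemma exhaust_6: "i = 0 \<or> i = 1 \<or> i = 2 \<or> i = 3 \<or> i = 4 \<or> i = 5" for i :: 6
proof (induct i)
  case (of_int z)
  then have "0 \<le> z" "z < 6" by simp_all
  then have "z = 0 \<or> z = 1 \<or> z = 2 \<or> z = 3 \<or> z = 4 \<or> z = 5" by arith
  then show ?case by auto
qed

lemma coords4_nth [simp]:
  "coords4 a b c d $ 0 = a" "coords4 a b c d $ 1 = b"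
  "coords4 a b c d $ 2 = c" "coords4 a b c d $ 3 = d"
  by (simp_all add: coords4_def)

lemma coords6_nth [simp]:
  "coords6 a b c d e f $ 0 = a" "coords6 a b c d e f $ 1 = b" "coords6 a b c d e f $ 2 = c"
  "coords6 a b c d e f $ 3 = d" "coords6 a b c d e f $ 4 = e" "coords6 a b c d e f $ 5 = f"
  by (simp_all add: coords6_def)

lemma vec4_eq_iff:
  "x = y \<longleftrightarrow> x $ 0 = y $ 0 \<and> x $ 1 = y $ 1 \<and> x $ 2 = y $ 2 \<and> x $ 3 = y $ 3" for x y :: "'a ^ 4"
proof -
  \<comment> \<open>\<open>forall_4\<close> runs through the indices 1, 2, 3, 4, while coordinates
    are numbered from 0; in the index type 4 is the same element as 0.\<close>
  have *: "(4 :: 4) = 0" by simp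
  show ?thesis unfolding vec_eq_iff forall_4 * by blast
qed

lemma vec6_eq_iff:
  "x = y \<longleftrightarrow> x $ 0 = y $ 0 \<and> x $ 1 = y $ 1 \<and> x $ 2 = y $ 2 \<and> x $ 3 = y $ 3 \<and>
     x $ 4 = y $ 4 \<and> x $ 5 = y $ 5"
  for x y :: "'a ^ 6"
proof -
  have "x $ i = y $ i"
    if "x $ 0 = y $ 0" "x $ 1 = y $ 1" "x $ 2 = y $ 2" "x $ 3 = y $ 3" "x $ 4 = y $ 4" "x $ 5 = y $ 5"
    for i
    using exhaust_6[of i] that by (elim disjE) simp_all
  then show ?thesis by (auto simp: vec_eq_iff)
qed

lemma pluecker_coords4:
  "pluecker (coords4 a b c d) (coords4 a' b' c' d') =
     coords6 (a * b' - b * a') (a * c' - c * a') (a * d' - d * a')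
       (b * c' - c * b') (b * d' - d * b') (c * d' - d * c')"
  by (simp add: pluecker_def Let_def)

lemma pluecker_scale_left: "pluecker (c *s q) q = 0"
  by (simp add: vec6_eq_iff pluecker_def Let_def)

section \<open>Points, joins and lines\<close>

lemma proj_point_eqE:
  assumes "proj_point p = proj_point q" "p \<noteq> 0"
  obtains c where "c \<noteq> 0" "p = c *s q"
proof -
  have "p \<in> vec.span {q}"
    using assms(1) vec.span_base[of p "{p}"] by (auto simp: proj_point_def)
  then obtain c where "p = c *s q" by (auto simp: vec.span_singleton)
  with assms(2) that show thesis by auto
qed

lemma proj_point_scale:
  assumes "c \<noteq> 0"
  shows "proj_point (c *s p) = proj_point p"
proof -
  have "inverse c *s (c *s p) \<in> vec.span {c *s p}"
    by (intro vec.span_scale vec.span_base) simp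
  then have "p \<in> vec.span {c *s p}" using assms by simp
  moreover have "c *s p \<in> vec.span {p}" by (intro vec.span_scale vec.span_base) simp
  ultimately show ?thesis by (simp add: proj_point_def vec.span_eq)
qed

text \<open>The coefficient matrix is invertible, so both pairs span the same subspace. This brings
  spanning pairs of lines into normal form.\<close>

lemma join_lincomb:
  fixes p q :: "'a::field ^ 'n"
  assumes "a * d - b * c \<noteq> 0"
  shows "join (a *s p + b *s q) (c *s p + d *s q) = join p q"
proof -
  define D where "D = a * d - b * c"
  let ?u = "a *s p + b *s q" and ?v = "c *s p + d *s q"
  have D: "D \<noteq> 0" using assms by (simp add: D_def)
  \<comment> \<open>Cramer's rule inverts the change of basis.\<close>
  have p: "p = (d / D) *s ?u + (- b / D) *s ?v" and q: "q = (- c / D) *s ?u + (a / D) *s ?v"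
    using D by (simp_all add: vec_eq_iff field_simps) (simp_all add: D_def algebra_simps)
  have "?u \<in> vec.span {p, q}" "?v \<in> vec.span {p, q}"
    by (simp_all add: vec.span_add vec.span_scale vec.span_base)
  moreover have "p \<in> vec.span {?u, ?v}" "q \<in> vec.span {?u, ?v}"
    by (subst p q, intro vec.span_add vec.span_scale vec.span_base, simp_all)+
  ultimately have "vec.span {?u, ?v} = vec.span {p, q}"
    by (simp add: vec.span_eq)
  then show ?thesis by (simp add: join_eq_iff)
qed

lemma in_span_2_iff: "x \<in> vec.span {p, q} \<longleftrightarrow> (\<exists>a b. x = a *s p + b *s q)"
  for p q x :: "'a::field ^ 'n"
proof
  show "\<exists>a b. x = a *s p + b *s q" if "x \<in> vec.span {p, q}"
    using that by (auto simp: vec.span_insert vec.span_singleton algebra_simps)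
  show "x \<in> vec.span {p, q}" if "\<exists>a b. x = a *s p + b *s q"
    using that by (elim exE) (simp add: vec.span_add vec.span_scale vec.span_base)
qed

lemma join_in_proj_lines_iff:
  "join p q \<in> proj_lines \<longleftrightarrow> vec.dim {p, q} = 2" for p q :: "'a::field ^ 'n"
proof
  assume "join p q \<in> proj_lines"
  then obtain U where U: "vec.subspace U" "vec.dim U = 2" "proj_points (vec.span {p, q}) = proj_points U"
    by (auto simp: proj_lines_def join_def)
  \<comment> \<open>A subspace is recovered from its set of points as their union together with
    0.\<close>
  then have "vec.span {p, q} = vec.span U"
    using span_proj_points vec.span_eq_iff by metis
  with U show "vec.dim {p, q} = 2" by (metis vec.dim_span)
next
  assume "vec.dim {p, q} = 2"
  then show "join p q \<in> proj_lines"
    unfolding proj_lines_def join_def by (auto intro!: exI[of _ "vec.span {p, q}"])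
qed

text \<open>Both vectors lie in the span of \<open>p\<close>, of dimension at most 1. This rules out
  dependent pairs when a join is known to be a line.\<close>

lemma join_scale_notin_proj_lines:
  "join p (c *s p) \<notin> proj_lines"
proof -
  have "vec.dim {p, c *s p} \<le> vec.dim (vec.span {p})"
    by (rule vec.dim_subset) (auto intro: vec.span_base vec.span_scale)
  also have "\<dots> \<le> card {p}" unfolding vec.dim_span by (rule vec.dim_le_card') simp
  finally show ?thesis by (simp add: join_in_proj_lines_iff)
qed

text \<open>If \<open>p\<close> were a multiple of \<open>q\<close>, all 2x2 minors would vanish; a
  nonzero Pluecker vector thus certifies independence.\<close>

lemma join_in_proj_lines:
  assumes "pluecker p q \<noteq> 0"
  shows "join p q \<in> proj_lines"
proof -
  have "q \<noteq> 0" using assms by (auto simp: vec6_eq_iff pluecker_def Let_def)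
  have "p \<notin> vec.span {q}" using assms pluecker_scale_left by (auto simp: vec.span_singleton)
  then have "vec.independent {p, q}" "p \<noteq> q"
    using \<open>q \<noteq> 0\<close> vec.span_base[of q "{q}"] by (auto simp: vec.independent_insert)
  then have "vec.dim {p, q} = 2" by (simp add: vec.dim_eq_card_independent)
  then show ?thesis by (simp add: join_in_proj_lines_iff)
qed

text \<open>The given vector \<open>p\<close> itself, not just some representative of its point,
  becomes a spanning vector. A second one exists because a subspace of dimension 2 does not fit into
  \<open>vec.span {p}\<close>.\<close>

lemma proj_line_through_pointE:
  fixes p :: "'a::field ^ 'n"
  assumes "l \<in> proj_lines" "proj_point p \<in> l" "p \<noteq> 0"
  obtains q where "l = join p q" "proj_point q \<in> l" "\<And>c. q \<noteq> c *s p"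
proof -
  from assms obtain U where U: "vec.subspace U" "vec.dim U = 2" "l = proj_points U"
    by (auto simp: proj_lines_def)
  from assms(2) U obtain p' where p': "p' \<in> U" "p' \<noteq> 0" "proj_point p = proj_point p'"
    by (auto simp: proj_points_def)
  obtain c where "p = c *s p'" using proj_point_eqE[OF p'(3) assms(3)] .
  then have "p \<in> U" using p'(1) U(1) by (simp add: vec.subspace_scale)
  have "\<not> U \<subseteq> vec.span {p}"
  proof
    assume "U \<subseteq> vec.span {p}"
    then have "vec.dim U \<le> card {p}" by (rule vec.dim_le_card) simp
    with U(2) show False by simp
  qed
  then obtain q where q: "q \<in> U" "q \<notin> vec.span {p}" by auto
  then have ind: "vec.independent {q, p}" "p \<noteq> q"
    using assms(3) vec.span_base[of q "{q}"] by (auto simp: vec.independent_insert)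
  have "vec.span {p, q} = U"
  proof
    show "vec.span {p, q} \<subseteq> U" using q \<open>p \<in> U\<close> U(1) by (intro vec.span_minimal) auto
    show "U \<subseteq> vec.span {p, q}"
      by (rule vec.card_ge_dim_independent) (use q \<open>p \<in> U\<close> ind U(2) in \<open>auto simp: insert_commute\<close>)
  qed
  moreover have "q \<noteq> c *s p" for c
    using q(2) by (auto simp: vec.span_singleton)
  moreover have "q \<noteq> 0" using q(2) vec.span_zero by auto
  ultimately show thesis
    using that[of q] q(1) U(3) by (auto simp: join_def proj_points_def)
qed

section \<open>Membership in varieties and the pencil of lines through Z in omega\<close>

text \<open>\<open>variety\<close> asks for vanishing at some representative only. The second
  assumption, a weak form of homogeneity, transfers it to the representative
  \<open>p\<close>.\<close>

lemma proj_point_in_variety_iff: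
  assumes "p \<noteq> 0" "\<And>g c. g \<in> G \<Longrightarrow> c \<noteq> 0 \<Longrightarrow> g (c *s p) = 0 \<Longrightarrow> g p = 0"
  shows "proj_point p \<in> variety G \<longleftrightarrow> (\<forall>g\<in>G. g p = 0)"
proof
  assume "proj_point p \<in> variety G"
  then obtain q where q: "proj_point q = proj_point p" "q \<noteq> 0" "\<forall>g\<in>G. g q = 0"
    by (auto simp: variety_def)
  from q(1,2) obtain c where "c \<noteq> 0" "q = c *s p" by (rule proj_point_eqE)
  with q assms(2) show "\<forall>g\<in>G. g p = 0" by blast
next
  assume "\<forall>g\<in>G. g p = 0"
  then show "proj_point p \<in> variety G" using assms(1) unfolding variety_def by blast
qed

lemma proj_point_in_omega_iff: "p \<noteq> 0 \<Longrightarrow> proj_point p \<in> omega \<longleftrightarrow> p $ 0 = 0"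
  unfolding omega_def by (subst proj_point_in_variety_iff) auto

text \<open>A second point of the line lies in \<open>omega\<close>, so its coordinate 0 vanishes;
  subtracting a multiple of the vector of Z clears the last coordinate.\<close>

lemma line_pencil_Z_omega:
  "line_pencil Z_point omega =
     {join (coords4 0 0 0 1) (coords4 0 a b 0) | a b :: 'a::field. (a, b) \<noteq> (0, 0)}"
proof (intro equalityI subsetI)
  fix l assume "l \<in> line_pencil (Z_point :: ('a ^ 4) set) omega"
  then have l: "l \<in> proj_lines" "proj_point (coords4 0 0 0 1) \<in> l" "l \<subseteq> omega"
    by (auto simp: line_pencil_def Z_point_def)
  have "coords4 0 0 0 1 \<noteq> (0 :: 'a ^ 4)" by (simp add: vec4_eq_iff)
  with l obtain q where q: "l = join (coords4 0 0 0 1) q" "proj_point q \<in> l"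
    "\<And>c. q \<noteq> c *s coords4 0 0 0 1"
    by (metis proj_line_through_pointE)
  have "q \<noteq> 0" using q(3)[of 0] by simp
  then have q0: "q $ 0 = 0" using q(2) l(3) proj_point_in_omega_iff by blast
  have "(q $ 1, q $ 2) \<noteq> (0, 0)" using q(3)[of "q $ 3"] q0 by (auto simp: vec4_eq_iff)
  moreover have "l = join (coords4 0 0 0 1) (coords4 0 (q $ 1) (q $ 2) 0)"
  proof -
    have "q = q $ 3 *s coords4 0 0 0 1 + 1 *s coords4 0 (q $ 1) (q $ 2) 0"
      using q0 by (simp add: vec4_eq_iff)
    \<comment> \<open>The scalars instantiate \<open>a\<close>, \<open>d\<close>, \<open>b\<close>,
      \<open>c\<close> in this order, so the matrix has rows \<open>1, 0\<close> and
      \<open>q $ 3, 1\<close>.\<close>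
    then show ?thesis
      using join_lincomb[of 1 1 0 "q $ 3" "coords4 0 0 0 1" "coords4 0 (q $ 1) (q $ 2) 0"] q(1)
      by simp
  qed
  ultimately show "l \<in> {join (coords4 0 0 0 1) (coords4 0 a b 0) | a b. (a, b) \<noteq> (0, 0)}"
    by blast
next
  fix l assume "l \<in> {join (coords4 0 0 0 1) (coords4 0 a b 0) | a b :: 'a. (a, b) \<noteq> (0, 0)}"
  then obtain a b :: 'a where ab: "(a, b) \<noteq> (0, 0)"
    and l: "l = join (coords4 0 0 0 1) (coords4 0 a b 0)" by blast
  have "l \<in> proj_lines"
    unfolding l by (rule join_in_proj_lines) (use ab in \<open>auto simp: pluecker_coords4 vec6_eq_iff\<close>)
  moreover have "Z_point \<in> l"
    unfolding l Z_point_def join_def proj_points_def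
    using vec.span_base[of "coords4 0 0 0 1" "{coords4 0 0 0 1, coords4 0 a b 0}"]
    by (auto simp: vec4_eq_iff)
  moreover have "l \<subseteq> omega"
    unfolding l join_def proj_points_def by (auto simp: proj_point_in_omega_iff in_span_2_iff)
  ultimately show "l \<in> line_pencil Z_point omega" by (simp add: line_pencil_def)
qed

text \<open>It is the member with \<open>a = 0\<close> and \<open>b = 1\<close>, so its Klein image
  is among those of the pencil.\<close>

lemma g_infinity_in_pencil: "g_infinity \<in> line_pencil Z_point omega"
proof -
  have "x $ 0 = 0 \<and> x $ 1 = 0 \<longleftrightarrow> x \<in> vec.span {coords4 0 0 0 1, coords4 0 0 1 0}" for x :: "'a ^ 4"
    by (auto simp: in_span_2_iff vec4_eq_iff)
  then have "g_infinity = join (coords4 0 0 0 1) (coords4 0 0 1 (0::'a))"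
    unfolding g_infinity_def variety_def join_def proj_points_def by auto
  then show ?thesis unfolding line_pencil_Z_omega by force
qed

section \<open>Simple points and proper osculating tangents of the Cayley surface\<close>

lemma simple_points_eq:
  "simple_points = {proj_point (coords4 1 u v (u * v - u ^ 3)) | u v :: 'a::field. True}"
proof (intro equalityI subsetI)
  fix P assume "P \<in> (simple_points :: ('a ^ 4) set set)"
  then obtain p where p: "P = proj_point p" "p \<noteq> 0" "cayley_form p = 0"
    and notin: "proj_point p \<notin> variety (range cayley_partial)"
    by (auto simp: simple_points_def cayley_surface_def variety_def[of "{cayley_form}"])
  have "p $ 0 \<noteq> 0"
  proof
    assume 0: "p $ 0 = 0"
    with p(3) have 1: "p $ 1 = 0" by (simp add: cayley_form_def)
    \<comment> \<open>Every monomial of the form has degree at least 2 in X0, X1 together, so each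
      partial derivative vanishes where X0 = X1 = 0.\<close>
    have "cayley_partial i p = 0" for i
      using 0 1 by (auto simp: cayley_partial_def cayley_form_def pderiv_minus pderiv_smult
          pderiv_power pderiv_mult pderiv_pCons power2_eq_square power3_eq_cube)
    then show False using notin p(2) by (auto simp: variety_def)
  qed
  define u v where "u = p $ 1 / p $ 0" and "v = p $ 2 / p $ 0"
  have "p = p $ 0 *s coords4 1 u v (u * v - u ^ 3)"
    using \<open>p $ 0 \<noteq> 0\<close> p(3)
    by (simp add: vec4_eq_iff u_def v_def cayley_form_def field_simps power2_eq_square power3_eq_cube)
  then have "P = proj_point (coords4 1 u v (u * v - u ^ 3))"
    using p(1) proj_point_scale[OF \<open>p $ 0 \<noteq> 0\<close>] by metis
  then show "P \<in> {proj_point (coords4 1 u v (u * v - u ^ 3)) | u v. True}" by blast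
next
  fix P assume "P \<in> {proj_point (coords4 1 u v (u * v - u ^ 3)) | u v :: 'a. True}"
  then obtain u v :: 'a where P: "P = proj_point (coords4 1 u v (u * v - u ^ 3))" by blast
  let ?p = "coords4 1 u v (u * v - u ^ 3)"
  have "?p \<noteq> 0" by (simp add: vec4_eq_iff)
  then have "P \<in> cayley_surface"
    unfolding P cayley_surface_def variety_def by (auto simp: cayley_form_def)
  \<comment> \<open>This one partial derivative is nonzero wherever X0 is, which makes the point
    simple.\<close>
  have *: "cayley_partial 3 q = - (q $ 0)\<^sup>2" for q :: "'a ^ 4"
    by (simp add: cayley_partial_def cayley_form_def pderiv_mult pderiv_diff pderiv_power power2_eq_square
        pderiv_pCons)
  have "P \<notin> variety (range cayley_partial)"
  proof
    assume "P \<in> variety (range cayley_partial)"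
    then obtain q where q: "proj_point q = proj_point ?p" "q \<noteq> 0" "cayley_partial 3 q = 0"
      unfolding P variety_def by auto
    from q(1,2) obtain c where "c \<noteq> 0" "q = c *s ?p" by (rule proj_point_eqE)
    with q(3) * show False by simp
  qed
  with \<open>P \<in> cayley_surface\<close> show "P \<in> simple_points" by (simp add: simple_points_def)
qed

text \<open>The three equations are the vanishing of the coefficients of 1, T and T^2 in f(p +
  Tq).\<close>

lemma contact_order_ge_3_iff:
  fixes p q :: "'a::field ^ 4"
  shows "[:0, 1:] ^ 3 dvd cayley_form (\<chi> i. [:p $ i, q $ i:]) \<longleftrightarrow>
    cayley_form p = 0 \<and>
    q $ 0 * p $ 1 * p $ 2 + p $ 0 * q $ 1 * p $ 2 + p $ 0 * p $ 1 * q $ 2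
      - 3 * (p $ 1)\<^sup>2 * q $ 1 - 2 * p $ 0 * q $ 0 * p $ 3 - (p $ 0)\<^sup>2 * q $ 3 = 0 \<and>
    q $ 0 * q $ 1 * p $ 2 + q $ 0 * p $ 1 * q $ 2 + p $ 0 * q $ 1 * q $ 2
      - 3 * p $ 1 * (q $ 1)\<^sup>2 - (q $ 0)\<^sup>2 * p $ 3 - 2 * p $ 0 * q $ 0 * q $ 3 = 0"
proof -
  have "[:0, 1:] ^ 3 dvd g \<longleftrightarrow> coeff g 0 = 0 \<and> coeff g 1 = 0 \<and> coeff g 2 = 0" for g :: "'a poly"
    using monom_1_dvd_iff'[of 3 g]
    by (auto simp: monom_altdef numeral_3_eq_3 less_Suc_eq numeral_2_eq_2)
  then show ?thesis
    by (simp add: cayley_form_def power2_eq_square power3_eq_cube coeff_pCons' algebra_simps)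
qed

lemma proper_osculating_tangents_eq:
  "proper_osculating_tangents =
     {join (coords4 1 u v (u * v - u ^ 3)) (coords4 0 1 (3 * u) v) | u v :: 'a::field. True}"
proof (intro equalityI subsetI)
  fix t assume "t \<in> (proper_osculating_tangents :: ('a ^ 4) set set set)"
  then obtain P where P: "P \<in> simple_points" "osculating_tangent_at P t" and ngen: "t \<notin> generators"
    by (auto simp: proper_osculating_tangents_def)
  from P(1) obtain u v where u: "P = proj_point (coords4 1 u v (u * v - u ^ 3))"
    unfolding simple_points_eq by blast
  from P(2) obtain p q where p: "P = proj_point p" and t: "t = join p q" "t \<in> proj_lines"
    and dvd: "[:0, 1:] ^ 3 dvd cayley_form (\<chi> i. [:p $ i, q $ i:])"
    unfolding osculating_tangent_at_def by blast
  let ?e = "coords4 1 u v (u * v - u ^ 3)"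
  have "?e \<noteq> 0" by (simp add: vec4_eq_iff)
  then obtain k where k: "k \<noteq> 0" "?e = k *s p" using u p by (metis proj_point_eqE)
  define c where "c = inverse k"
  have c: "c \<noteq> 0" "p = c *s ?e" using k by (simp_all add: c_def)
  \<comment> \<open>Subtracting \<open>m *s ?e\<close> moves the direction into the plane X0 =
    0.\<close>
  define m a b d where "m = q $ 0" and "a = q $ 1 - m * u" and "b = q $ 2 - m * v"
    and "d = q $ 3 - m * (u * v - u ^ 3)"
  have q: "q = m *s ?e + coords4 0 a b d"
    by (simp add: vec4_eq_iff m_def a_def b_def d_def)
  \<comment> \<open>The coefficient of T. The terms with \<open>m\<close> cancel because f vanishes
    at \<open>?e\<close>.\<close>
  have "c\<^sup>2 * (u * b + a * v - 3 * u\<^sup>2 * a - d) = 0"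
    using dvd unfolding contact_order_ge_3_iff c(2) q
    by (simp add: algebra_simps power2_eq_square power3_eq_cube)
  then have d: "d = u * b + a * v - 3 * u\<^sup>2 * a" using c(1) by simp
  \<comment> \<open>The coefficient of T^2, with the tangency condition \<open>d\<close>
    substituted; again no term with \<open>m\<close> survives.\<close>
  have "c * a * (b - 3 * u * a) = 0"
    using dvd unfolding contact_order_ge_3_iff c(2) q d
    by (simp add: algebra_simps power2_eq_square power3_eq_cube)
  then consider "a = 0" | "a \<noteq> 0" "b = 3 * u * a" using c(1) by auto
  then show "t \<in> {join (coords4 1 u v (u * v - u ^ 3)) (coords4 0 1 (3 * u) v) | u v. True}"
  proof cases
    case 1
    have "b \<noteq> 0"
    proof
      assume "b = 0"
      with 1 d have "q = (m / c) *s p" using c q by (simp add: vec4_eq_iff)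
      with t show False using join_scale_notin_proj_lines by metis
    qed
    \<comment> \<open>For \<open>a = 0\<close> the reduced direction is
      \<open>b *s coords4 0 0 1 u\<close>, and \<open>?e\<close> is the first generator vector for
      \<open>s0 = 1\<close>, \<open>s1 = u\<close> plus \<open>v - u\<^sup>2\<close> times the
      second. The determinant of the change of basis is \<open>c * b\<close>.\<close>
    have "p = c *s coords4 1 u (u\<^sup>2) 0 + (c * (v - u\<^sup>2)) *s coords4 0 0 1 u"
      "q = m *s coords4 1 u (u\<^sup>2) 0 + (m * (v - u\<^sup>2) + b) *s coords4 0 0 1 u"
      using c q d 1 by (simp_all add: vec4_eq_iff algebra_simps power2_eq_square power3_eq_cube)
    moreover have "c * (m * (v - u\<^sup>2) + b) - c * (v - u\<^sup>2) * m \<noteq> 0"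
      using c(1) \<open>b \<noteq> 0\<close> by (simp add: algebra_simps)
    ultimately have "t = join (coords4 1 u (u\<^sup>2) 0) (coords4 0 0 1 u)"
      unfolding t(1) by (metis join_lincomb)
    then have "t \<in> generators"
      unfolding generators_def by (intro CollectI exI[of _ 1] exI[of _ u]) simp
    with ngen show ?thesis by simp
  next
    case 2
    \<comment> \<open>With \<open>b = 3 * u * a\<close> the tangency condition becomes
      \<open>d = a * v\<close>, so the reduced direction is \<open>a\<close> times the normal
      form.\<close>
    have "p = c *s ?e + 0 *s coords4 0 1 (3 * u) v" "q = m *s ?e + a *s coords4 0 1 (3 * u) v"
      using c q d 2 by (simp_all add: vec4_eq_iff algebra_simps power2_eq_square)
    moreover have "c * a - 0 * m \<noteq> 0" using c(1) 2(1) by simp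
    ultimately have "t = join ?e (coords4 0 1 (3 * u) v)"
      unfolding t(1) by (metis join_lincomb)
    then show ?thesis by blast
  qed
next
  fix t assume "t \<in> {join (coords4 1 u v (u * v - u ^ 3)) (coords4 0 1 (3 * u) v) | u v :: 'a. True}"
  then obtain u v :: 'a where
    t: "t = join (coords4 1 u v (u * v - u ^ 3)) (coords4 0 1 (3 * u) v)" by blast
  let ?e = "coords4 1 u v (u * v - u ^ 3)" and ?w = "coords4 0 1 (3 * u) v"
  have y0: "pluecker ?e ?w $ 0 = 1" by (simp add: pluecker_coords4)
  then have y: "pluecker ?e ?w \<noteq> 0" by (metis zero_index zero_neq_one)
  have "[:0, 1:] ^ 3 dvd cayley_form (\<chi> i. [:?e $ i, ?w $ i:])"
    unfolding contact_order_ge_3_iff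
    by (simp add: cayley_form_def algebra_simps power2_eq_square)
  then have "osculating_tangent_at (proj_point ?e) t"
    unfolding osculating_tangent_at_def t using join_in_proj_lines[OF y] by blast
  moreover have "proj_point ?e \<in> simple_points" unfolding simple_points_eq by blast
  \<comment> \<open>The Klein images separate the lines: Y01 is 0 for every generator, but 1 for the
    pair spanning \<open>t\<close>.\<close>
  moreover have "t \<notin> generators"
  proof
    assume "t \<in> generators"
    then obtain s0 s1 where "t = join (coords4 (s0\<^sup>2) (s0 * s1) (s1\<^sup>2) 0) (coords4 0 0 s0 s1)"
      by (auto simp: generators_def)
    then have "proj_point (pluecker ?e ?w) =
        proj_point (pluecker (coords4 (s0\<^sup>2) (s0 * s1) (s1\<^sup>2) 0) (coords4 0 0 s0 s1))"
      using t klein_map_join by metis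
    then obtain c where "pluecker ?e ?w =
        c *s pluecker (coords4 (s0\<^sup>2) (s0 * s1) (s1\<^sup>2) 0) (coords4 0 0 s0 s1)"
      using y by (rule proj_point_eqE)
    then have "pluecker ?e ?w $ 0 = 0" by (simp add: pluecker_coords4)
    with y0 show False by simp
  qed
  ultimately show "t \<in> proper_osculating_tangents"
    unfolding proper_osculating_tangents_def by blast
qed

section \<open>The intersection of J with the Klein quadric\<close>

text \<open>A common point may come with different representatives in the two varieties; the one
  from \<open>G\<close> is kept, and the assumption on \<open>H\<close> transfers vanishing to
  it.\<close>

lemma variety_Int:
  assumes "\<And>h c y. h \<in> H \<Longrightarrow> c \<noteq> 0 \<Longrightarrow> h (c *s y) = 0 \<Longrightarrow> h y = 0"
  shows "variety G \<inter> variety H = {proj_point y | y. y \<noteq> 0 \<and> (\<forall>h\<in>G \<union> H. h y = 0)}"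
proof (intro equalityI subsetI)
  fix P assume "P \<in> variety G \<inter> variety H"
  then obtain y where y: "P = proj_point y" "y \<noteq> 0" "\<forall>h\<in>G. h y = 0" "proj_point y \<in> variety H"
    by (auto simp: variety_def[of G])
  then have "\<forall>h\<in>H. h y = 0" using assms by (subst (asm) proj_point_in_variety_iff) auto
  with y show "P \<in> {proj_point y | y. y \<noteq> 0 \<and> (\<forall>h\<in>G \<union> H. h y = 0)}" by blast
qed (auto simp: variety_def)

lemma klein_quadric_scale:
  fixes y :: "'a::field ^ 6"
  assumes "c \<noteq> 0"
    "(c *s y) $ 0 * (c *s y) $ 5 - (c *s y) $ 1 * (c *s y) $ 4 + (c *s y) $ 2 * (c *s y) $ 3 = 0"
  shows "y $ 0 * y $ 5 - y $ 1 * y $ 4 + y $ 2 * y $ 3 = 0"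
proof -
  have "c\<^sup>2 * (y $ 0 * y $ 5 - y $ 1 * y $ 4 + y $ 2 * y $ 3) = 0"
    using assms(2) by (simp add: algebra_simps power2_eq_square)
  with assms(1) show ?thesis by simp
qed

lemma three_neq_zero:
  assumes "CHAR('a::field) \<noteq> 3"
  shows "(3 :: 'a) \<noteq> 0"
proof
  assume "(3 :: 'a) = 0"
  then have "CHAR('a) dvd 3" using of_nat_eq_0_iff_char_dvd[of 3, where 'a='a] by simp
  moreover have "prime (3 :: nat)" by simp
  ultimately show False using assms CHAR_not_1'[where 'a='a] by (auto simp: prime_nat_iff)
qed

lemma J_Int_klein_quadric:
  assumes "CHAR('a::field) \<noteq> 3"
  shows "variety {h1, h2, h3 :: 'a ^ 6 \<Rightarrow> 'a} \<inter> klein_quadric =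
    {proj_point (coords6 1 (3 * u) v (3 * u\<^sup>2 - v) (u ^ 3) (3 * u ^ 4 - 3 * u\<^sup>2 * v + v\<^sup>2)) | u v. True} \<union>
    {proj_point (coords6 0 0 0 0 a b) | a b. (a, b) \<noteq> (0, 0)}"
    (is "?J = ?A \<union> ?B")
proof (intro equalityI subsetI)
  have three: "(3 :: 'a) \<noteq> 0" using assms by (rule three_neq_zero)
  then have nine: "(9 :: 'a) \<noteq> 0" using mult_eq_0_iff[of "3 :: 'a" 3] by simp
  have J: "?J = {proj_point y | y. y \<noteq> 0 \<and> h1 y = 0 \<and> h2 y = 0 \<and> h3 y = 0 \<and>
      y $ 0 * y $ 5 - y $ 1 * y $ 4 + y $ 2 * y $ 3 = 0}"
    unfolding klein_quadric_def
    by (subst variety_Int) (auto dest: klein_quadric_scale simp del: vector_smult_component)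
  {
    fix P assume "P \<in> ?J"
    then obtain y where P: "P = proj_point y" "y \<noteq> 0"
      and h: "h1 y = 0" "h2 y = 0" "h3 y = 0"
      and k: "y $ 0 * y $ 5 - y $ 1 * y $ 4 + y $ 2 * y $ 3 = 0"
      unfolding J by blast
    show "P \<in> ?A \<union> ?B"
    proof (cases "y $ 0 = 0")
      case True
      \<comment> \<open>With Y01 = 0, \<open>h1\<close> leaves the square of Y02; then
        \<open>h2\<close> leaves the square of Y12 + Y03, and the quadric finally leaves the square
        of Y03 up to sign.\<close>
      then have y1: "y $ 1 = 0" using h(1) by (simp add: h1_def)
      then have y3: "y $ 3 = - y $ 2" using h(2) by (simp add: h2_def eq_neg_iff_add_eq_0)
      then have y2: "y $ 2 = 0" using k True y1 by simp
      obtain a b where y: "y = coords6 0 0 0 0 a b"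
        using that[of "y $ 4" "y $ 5"] True y1 y2 y3 by (simp add: vec6_eq_iff)
      then have "(a, b) \<noteq> (0, 0)" using P(2) by (auto simp: vec6_eq_iff)
      then have "P \<in> ?B" unfolding P(1) y by blast
      then show ?thesis ..
    next
      case False
      define c u v where "c = y $ 0" and "u = y $ 1 / (3 * c)" and "v = y $ 2 / c"
      have c: "c \<noteq> 0" using False by (simp add: c_def)
      have y: "y $ 0 = c" "y $ 1 = c * (3 * u)" "y $ 2 = c * v"
        using c three by (simp_all add: c_def u_def v_def)
      \<comment> \<open>The remaining coordinates are solved for one by one, each equation being
        linear in its unknown: \<open>h1\<close> gives Y12, \<open>h3\<close> gives Y13 and the
        quadric gives Y23.\<close>
      have "3 * c * (y $ 3 - c * (3 * u\<^sup>2 - v)) = 0"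
        using h(1) unfolding h1_def y by (simp add: algebra_simps power2_eq_square)
      then have y3: "y $ 3 = c * (3 * u\<^sup>2 - v)" using c three by simp
      have "9 * c * (y $ 4 - c * u ^ 3) = 0"
        using h(3) unfolding h3_def y y3 by (simp add: algebra_simps power2_eq_square power3_eq_cube)
      then have y4: "y $ 4 = c * u ^ 3" using c nine by simp
      have "c * (y $ 5 - c * (3 * u ^ 4 - 3 * u\<^sup>2 * v + v\<^sup>2)) = 0"
        using k unfolding y y3 y4 by (simp add: algebra_simps power2_eq_square power3_eq_cube power4_eq_xxxx)
      then have y5: "y $ 5 = c * (3 * u ^ 4 - 3 * u\<^sup>2 * v + v\<^sup>2)" using c by simp
      have "y = c *s coords6 1 (3 * u) v (3 * u\<^sup>2 - v) (u ^ 3) (3 * u ^ 4 - 3 * u\<^sup>2 * v + v\<^sup>2)"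
        by (simp add: vec6_eq_iff y y3 y4 y5)
      then show ?thesis using P(1) proj_point_scale[OF c] by blast
    qed
  }
  fix P assume "P \<in> ?A \<union> ?B"
  then show "P \<in> ?J"
  proof
    assume "P \<in> ?A"
    then obtain u v where P: "P = proj_point
        (coords6 1 (3 * u) v (3 * u\<^sup>2 - v) (u ^ 3) (3 * u ^ 4 - 3 * u\<^sup>2 * v + v\<^sup>2))" by blast
    show ?thesis unfolding J P
      by (intro CollectI exI conjI, rule refl)
        (simp_all add: vec6_eq_iff h1_def h2_def h3_def algebra_simps
          power2_eq_square power3_eq_cube power4_eq_xxxx)
  next
    assume "P \<in> ?B"
    then obtain a b where P: "P = proj_point (coords6 0 0 0 0 a b)" "(a, b) \<noteq> (0, 0)" by blast
    show ?thesis unfolding J P(1)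
      by (intro CollectI exI conjI, rule refl)
        (use P(2) in \<open>auto simp: vec6_eq_iff h1_def h2_def h3_def\<close>)
  qed
qed

section \<open>Images under the Klein mapping\<close>

theorem theorem4p3:
  assumes "CHAR('a::field) \<noteq> 3"
  shows "klein_map ` (osculating_set \<union> line_pencil Z_point omega) =
    variety {h1, h2, h3 :: 'a ^ 6 \<Rightarrow> 'a} \<inter> klein_quadric"
proof -
  have osc: "pluecker (coords4 1 u v (u * v - u ^ 3)) (coords4 0 1 (3 * u) v) =
      coords6 1 (3 * u) v (3 * u\<^sup>2 - v) (u ^ 3) (3 * u ^ 4 - 3 * u\<^sup>2 * v + v\<^sup>2)" for u v :: 'a
    by (simp add: pluecker_coords4 vec6_eq_iff algebra_simps power2_eq_square power3_eq_cube
        power4_eq_xxxx)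
  have pencil: "klein_map ` line_pencil Z_point omega =
      {proj_point (coords6 0 0 0 0 a b) | a b :: 'a. (a, b) \<noteq> (0, 0)}"
  proof (intro equalityI subsetI)
    fix P :: "('a ^ 6) set" assume "P \<in> klein_map ` line_pencil Z_point omega"
    then obtain a b :: 'a where "(a, b) \<noteq> (0, 0)"
      "P = klein_map (join (coords4 0 0 0 1) (coords4 0 a b 0))"
      unfolding line_pencil_Z_omega by blast
    \<comment> \<open>The Pluecker coordinates Y13 and Y23 of this pair are \<open>- a\<close> and
      \<open>- b\<close>; the change of sign only permutes the parameters.\<close>
    then have "(- a, - b) \<noteq> (0, 0)" "P = proj_point (coords6 0 0 0 0 (- a) (- b))"
      by (simp_all add: klein_map_join pluecker_coords4)
    then show "P \<in> {proj_point (coords6 0 0 0 0 a b) | a b. (a, b) \<noteq> (0, 0)}" by blast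
  next
    fix P assume "P \<in> {proj_point (coords6 0 0 0 0 a b) | a b :: 'a. (a, b) \<noteq> (0, 0)}"
    then obtain a b :: 'a where ab: "(a, b) \<noteq> (0, 0)" "P = proj_point (coords6 0 0 0 0 a b)"
      by blast
    then have "P = klein_map (join (coords4 0 0 0 1) (coords4 0 (- a) (- b) 0))"
      by (simp add: klein_map_join pluecker_coords4)
    with ab(1) show "P \<in> klein_map ` line_pencil Z_point omega"
      unfolding line_pencil_Z_omega by force
  qed
  have "osculating_set \<union> line_pencil Z_point omega =
      proper_osculating_tangents \<union> line_pencil Z_point (omega :: ('a ^ 4) set set)"
    using g_infinity_in_pencil by (auto simp: osculating_set_def)
  moreover have "klein_map ` proper_osculating_tangents = {proj_point
      (coords6 1 (3 * u) v (3 * u\<^sup>2 - v) (u ^ 3) (3 * u ^ 4 - 3 * u\<^sup>2 * v + v\<^sup>2)) | u v :: 'a. True}"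
    \<comment> \<open>Read backwards, the two equations turn each point on the right into the Klein
      image of a parametrised tangent.\<close>
    unfolding proper_osculating_tangents_eq osc[symmetric] klein_map_join[symmetric] by blast
  ultimately show ?thesis
    by (simp only: image_Un pencil J_Int_klein_quadric[OF assms])
qed

end
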